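(* Let $S$ be a weak Gaussian semiring and $B$ a McCoy and weak content $S$-semialgebra whose content function $c$ is homogeneous and whose corresponding homomorphism $\lambda:S\to B$ is injective. Then $S$ has very few zero-divisors if and only if $B$ has very few zero-divisors.
   Context: A semiring is a set $S$ with operations $+,\cdot$ such that $(S,+)$ is a commutative monoid with identity $0$, $(S,\cdot)$ is a commutative monoid with identity $1\neq 0$, multiplication distributes over addition, and $s\cdot 0=0$ for all $s\in S$. An ideal of $S$ is a nonempty subset closed under addition and under multiplication by elements of $S$; a proper ideal $\mathbf p$ is prime if $ab\in\mathbf p$ implies $a\in\mathbf p$ or $b\in\mathbf p$. $\sqrt I=\{s\in S:s^n\in I\text{ for some }n\ge1\}$. $S$ is weak Gaussian if $A_fA_g\subseteq\sqrt{A_{fg}}$ for all $f,g\in S[X]$, where $A_f$ is the ideal generated by the coefficients of $f$; equivalently (known), every prime ideal $\mathbf p$ of $S$ is subtractive, i.e. $a+b,a\in\mathbf p$ imply $b\in\mathbf p$. An $S$-semialgebra is a semiring $B$ with a semiring morphism $\lambda:S\to B$ (preserving $+,\cdot,0,1$); write $s\cdot f=\lambda(s)f$, and for an ideal $I$ of $S$ let $IB$ be the ideal of $B$ generated by $\lambda(I)$. For $f\in B$, the content $c(f)$ is the intersection of all ideals $I$ of $S$ with $f\in IB$. $B$ is an Ohm-Rush $S$-semialgebra if $f\in c(f)B$ for all $f\in B$. An Ohm-Rush $S$-semialgebra $B$ is: a McCoy $S$-semialgebra if $g\cdot f=0$ with $g,f\in B$, $g\neq0$, implies $s\cdot c(f)=0$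 for some nonzero $s\in S$; a weak content $S$-semialgebra if $c(f)c(g)\subseteq\sqrt{c(fg)}$ for all $f,g\in B$. The content function is homogeneous if $c(s\cdot f)=s\cdot c(f)$ for all $s\in S$, $f\in B$. For a semiring $S$, $Z(S)$ is the set of $s\in S$ with $st=0$ for some nonzero $t\in S$; $\mathrm{Ass}(S)$ is the set of prime ideals of $S$ of the form $\mathrm{Ann}(t)=\{s\in S: st=0\}$, $t\in S$. $S$ has very few zero-divisors if $Z(S)$ is a finite union of primes in $\mathrm{Ass}(S)$ (similarly for $B$). *)

theory Defs
  imports "HOL-Computational_Algebra.Polynomial"
begin

text \<open>
  A semiring is a type of class \<open>comm_semiring_1\<close>: this class has commutative multiplication,
  \<open>0 \<noteq> 1\<close> and \<open>0 * a = 0\<close>, and does not require cancellation or subtraction.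
\<close>

definition is_ideal :: "'a::comm_semiring_1 set \<Rightarrow> bool" where
  "is_ideal I \<longleftrightarrow> I \<noteq> {} \<and> (\<forall>a\<in>I. \<forall>b\<in>I. a + b \<in> I) \<and> (\<forall>s. \<forall>a\<in>I. s * a \<in> I)"

definition ideal_generated :: "'a::comm_semiring_1 set \<Rightarrow> 'a set" where
  "ideal_generated A = is_ideal hull A"

definition ideal_mult :: "'a::comm_semiring_1 set \<Rightarrow> 'a set \<Rightarrow> 'a set" where
  "ideal_mult I J = ideal_generated {a * b |a b. a \<in> I \<and> b \<in> J}"

definition prime_ideal :: "'a::comm_semiring_1 set \<Rightarrow> bool" where
  "prime_ideal p \<longleftrightarrow> is_ideal p \<and> p \<noteq> UNIV \<and> (\<forall>a b. a * b \<in> p \<longrightarrow> a \<in> p \<or> b \<in> p)"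

definition ideal_radical :: "'a::comm_semiring_1 set \<Rightarrow> 'a set" where
  "ideal_radical I = {s. \<exists>n\<ge>1. s ^ n \<in> I}"

definition coeff_ideal :: "'a::comm_semiring_1 poly \<Rightarrow> 'a set" where
  "coeff_ideal f = ideal_generated (range (coeff f))"

definition weak_gaussian :: "'a::comm_semiring_1 itself \<Rightarrow> bool" where
  "weak_gaussian _ \<longleftrightarrow> (\<forall>f g :: 'a poly.
     ideal_mult (coeff_ideal f) (coeff_ideal g) \<subseteq> ideal_radical (coeff_ideal (f * g)))"

definition annihilator :: "'a::comm_semiring_1 \<Rightarrow> 'a set" where
  "annihilator t = {s. s * t = 0}"

definition zero_divisors :: "'a::comm_semiring_1 set" where
  "zero_divisors = {s. \<exists>t. t \<noteq> 0 \<and> s * t = 0}"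

definition associated_primes :: "'a::comm_semiring_1 set set" where
  "associated_primes = {p. prime_ideal p \<and> (\<exists>t. p = annihilator t)}"

definition very_few_zero_divisors :: "'a::comm_semiring_1 itself \<Rightarrow> bool" where
  "very_few_zero_divisors _ \<longleftrightarrow>
     (\<exists>P. finite P \<and> P \<subseteq> (associated_primes :: 'a set set) \<and> zero_divisors = \<Union>P)"

text \<open>
  A semialgebra over \<open>'a\<close> is given by its structure map \<open>h :: 'a \<Rightarrow> 'b\<close>; the scalar action
  of \<open>s\<close> on \<open>f\<close> is \<open>h s * f\<close>.
\<close>

definition semialgebra :: "('a::comm_semiring_1 \<Rightarrow> 'b::comm_semiring_1) \<Rightarrow> bool" where
  "semialgebra h \<longleftrightarrow> h 0 = 0 \<and> h 1 = 1 \<and>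
     (\<forall>s t. h (s + t) = h s + h t) \<and> (\<forall>s t. h (s * t) = h s * h t)"

definition extend_ideal ::
  "('a::comm_semiring_1 \<Rightarrow> 'b::comm_semiring_1) \<Rightarrow> 'a set \<Rightarrow> 'b set" where
  "extend_ideal h I = ideal_generated (h ` I)"

definition ohm_rush_content ::
  "('a::comm_semiring_1 \<Rightarrow> 'b::comm_semiring_1) \<Rightarrow> 'b \<Rightarrow> 'a set" where
  "ohm_rush_content h f = \<Inter>{I. is_ideal I \<and> f \<in> extend_ideal h I}"

definition ohm_rush_semialgebra ::
  "('a::comm_semiring_1 \<Rightarrow> 'b::comm_semiring_1) \<Rightarrow> bool" where
  "ohm_rush_semialgebra h \<longleftrightarrow> semialgebra h \<and>
     (\<forall>f. f \<in> extend_ideal h (ohm_rush_content h f))"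

definition mccoy_semialgebra ::
  "('a::comm_semiring_1 \<Rightarrow> 'b::comm_semiring_1) \<Rightarrow> bool" where
  "mccoy_semialgebra h \<longleftrightarrow> ohm_rush_semialgebra h \<and>
     (\<forall>g f. g * f = 0 \<and> g \<noteq> 0 \<longrightarrow> (\<exists>s. s \<noteq> 0 \<and> (*) s ` ohm_rush_content h f = {0}))"

definition weak_content_semialgebra ::
  "('a::comm_semiring_1 \<Rightarrow> 'b::comm_semiring_1) \<Rightarrow> bool" where
  "weak_content_semialgebra h \<longleftrightarrow> ohm_rush_semialgebra h \<and>
     (\<forall>f g. ideal_mult (ohm_rush_content h f) (ohm_rush_content h g)
              \<subseteq> ideal_radical (ohm_rush_content h (f * g)))"

definition homogeneous_content ::
  "('a::comm_semiring_1 \<Rightarrow> 'b::comm_semiring_1) \<Rightarrow> bool" where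
  "homogeneous_content h \<longleftrightarrow>
     (\<forall>s f. ohm_rush_content h (h s * f) = (*) s ` ohm_rush_content h f)"

end

theory Submission
  imports Defs
begin

text \<open>
  For \<open>t\<close> in the base semiring, homogeneity of the content gives
  \<open>annihilator (h t) = {f. c(f) \<subseteq> annihilator t}\<close>, so annihilator primes extend to annihilator
  primes by the weak content property. McCoy's property places the content of a zero-divisor inside
  the zero-divisors, and prime avoidance moves it into a single prime; avoidance over semirings
  needs subtractive primes, and annihilators are always subtractive. Conversely, a prime
  \<open>annihilator g\<close> contracts to the annihilator of \<open>c(g)\<close>; since \<open>g\<close> only involves finitely many
  elements of \<open>c(g)\<close> and the contraction is prime, it is the annihilator of one of them.
\<close>

section \<open>Ideals of semirings\<close>

lemma is_ideal_zero: "is_ideal I \<Longrightarrow> 0 \<in> I"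
  unfolding is_ideal_def by (metis ex_in_conv mult_zero_left)

lemma is_ideal_add: "is_ideal I \<Longrightarrow> a \<in> I \<Longrightarrow> b \<in> I \<Longrightarrow> a + b \<in> I"
  unfolding is_ideal_def by blast

lemma is_ideal_mult: "is_ideal I \<Longrightarrow> a \<in> I \<Longrightarrow> s * a \<in> I"
  unfolding is_ideal_def by blast

lemma is_ideal_Inter: "(\<And>I. I \<in> \<I> \<Longrightarrow> is_ideal I) \<Longrightarrow> is_ideal (\<Inter>\<I>)"
  unfolding is_ideal_def[of "\<Inter>\<I>"]
  using is_ideal_zero is_ideal_add is_ideal_mult by blast

lemma is_ideal_singleton_zero: "is_ideal {0}"
  by (simp add: is_ideal_def)

lemma is_ideal_annihilator: "is_ideal (annihilator t)"
proof -
  have "0 \<in> annihilator t"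
    by (simp add: annihilator_def)
  then have "annihilator t \<noteq> {}" by blast
  then show ?thesis
    unfolding is_ideal_def by (simp add: annihilator_def distrib_right mult.assoc)
qed

lemma is_ideal_ideal_generated: "is_ideal (ideal_generated A)"
  unfolding ideal_generated_def by (rule hull_in) (auto intro: is_ideal_Inter)

lemma ideal_generated_superset: "A \<subseteq> ideal_generated A"
  unfolding ideal_generated_def by (rule hull_subset)

lemma ideal_generated_minimal: "A \<subseteq> I \<Longrightarrow> is_ideal I \<Longrightarrow> ideal_generated A \<subseteq> I"
  unfolding ideal_generated_def by (rule hull_minimal)

lemma ideal_generated_mono: "A \<subseteq> B \<Longrightarrow> ideal_generated A \<subseteq> ideal_generated B"
  unfolding ideal_generated_def by (rule hull_mono)

text \<open>The elements that need only finitely many generators already form an ideal containing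
  \<open>A\<close>: a sum uses the union of the two finite sets, a multiple the same set. This later
  cuts a content down to finitely many of its elements.\<close>

lemma ideal_generated_finite_subset:
  assumes "x \<in> ideal_generated A"
  shows "\<exists>F. finite F \<and> F \<subseteq> A \<and> x \<in> ideal_generated F"
proof -
  let ?J = "{x. \<exists>F. finite F \<and> F \<subseteq> A \<and> x \<in> ideal_generated F}"
  have "is_ideal ?J"
    unfolding is_ideal_def
  proof (intro conjI ballI allI)
    show "?J \<noteq> {}"
      using is_ideal_zero[OF is_ideal_ideal_generated[of "{}"]] by blast
  next
    fix a b assume "a \<in> ?J" "b \<in> ?J"
    then obtain F G where "finite F" "F \<subseteq> A" "a \<in> ideal_generated F"
      and "finite G" "G \<subseteq> A" "b \<in> ideal_generated G"
      by blast
    moreover from this have "a + b \<in> ideal_generated (F \<union> G)"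
      using ideal_generated_mono[of F "F \<union> G"] ideal_generated_mono[of G "F \<union> G"]
      by (blast intro: is_ideal_add[OF is_ideal_ideal_generated])
    ultimately show "a + b \<in> ?J"
      by (intro CollectI exI[of _ "F \<union> G"]) auto
  next
    fix s a assume "a \<in> ?J"
    then show "s * a \<in> ?J"
      using is_ideal_mult[OF is_ideal_ideal_generated] by blast
  qed
  moreover have "A \<subseteq> ?J"
    using ideal_generated_superset by (intro subsetI CollectI, rule_tac x = "{x}" in exI) auto
  ultimately show ?thesis
    using ideal_generated_minimal assms by blast
qed

section \<open>Prime ideals\<close>

lemma prime_ideal_is_ideal: "prime_ideal p \<Longrightarrow> is_ideal p"
  by (simp add: prime_ideal_def)

lemma prime_ideal_mult: "prime_ideal p \<Longrightarrow> a * b \<in> p \<Longrightarrow> a \<in> p \<or> b \<in> p"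
  by (simp add: prime_ideal_def)

lemma prime_ideal_one_notin:
  assumes "prime_ideal p" shows "1 \<notin> p"
  using assms is_ideal_mult[of p 1] by (auto simp: prime_ideal_def)

lemma prime_ideal_prod:
  assumes "prime_ideal p" "finite F" "(\<Prod>x\<in>F. f x) \<in> p"
  shows "\<exists>x\<in>F. f x \<in> p"
  using assms(2,3)
  by (induction F) (use assms(1) in \<open>auto dest: prime_ideal_mult prime_ideal_one_notin\<close>)

lemma prime_ideal_power:
  assumes "prime_ideal p" "x ^ n \<in> p"
  shows "x \<in> p"
  using assms(2)
  by (induction n) (use assms(1) in \<open>auto dest: prime_ideal_mult prime_ideal_one_notin\<close>)

lemma ideal_radical_subset_prime:
  "prime_ideal p \<Longrightarrow> I \<subseteq> p \<Longrightarrow> ideal_radical I \<subseteq> p"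
  unfolding ideal_radical_def by (auto dest: prime_ideal_power)

lemma ideal_prod_mem:
  assumes "is_ideal I" "finite F" "x \<in> F" "f x \<in> I"
  shows "(\<Prod>y\<in>F. f y) \<in> I"
  using is_ideal_mult[OF assms(1,4), of "\<Prod>y\<in>F - {x}. f y"] prod.remove[OF assms(2,3), of f]
  by (simp add: mult.commute)

text \<open>Redundant primes are discarded by induction on \<open>P\<close>. Once none is redundant,
  each \<open>p\<close> has a private element of \<open>I\<close>, lying in \<open>p\<close> and in
  no other member, and one private element plus the product of the others escapes every prime.
  Subtractivity stands in for the subtraction of the ring argument.\<close>

lemma prime_avoidance:
  assumes "finite P" "is_ideal I" "I \<subseteq> \<Union>P"
    and "\<And>p. p \<in> P \<Longrightarrow> prime_ideal p"
    and "\<And>p a b. p \<in> P \<Longrightarrow> a + b \<in> p \<Longrightarrow> a \<in> p \<Longrightarrow> b \<in> p"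
  shows "\<exists>p\<in>P. I \<subseteq> p"
  using assms(1,3-)
proof (induction P rule: finite_psubset_induct)
  case (psubset P)
  show ?case
  proof (cases "\<exists>p\<in>P. I \<subseteq> \<Union>(P - {p})")
    case True
    then obtain p where "p \<in> P" and sub: "I \<subseteq> \<Union>(P - {p})" by blast
    then have "P - {p} \<subset> P" by blast
    from psubset.IH[OF this sub] psubset.prems(2,3) show ?thesis by blast
  next
    case False
    then have "\<forall>p\<in>P. \<exists>a. a \<in> I \<and> a \<notin> \<Union>(P - {p})" by blast
    then obtain a where a: "\<And>p. p \<in> P \<Longrightarrow> a p \<in> I \<and> a p \<notin> \<Union>(P - {p})" by metis
    have a_self: "a p \<in> p" if "p \<in> P" for p
      using a[OF that] psubset.prems(1) by blast
    obtain p where p: "p \<in> P"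
      using is_ideal_zero[OF assms(2)] psubset.prems(1) by blast
    define b where "b = (\<Prod>q\<in>P - {p}. a q)"
    have fin: "finite (P - {p})" using psubset.hyps by simp
    show ?thesis
    \<comment> \<open>For a single prime \<open>b\<close> would be the empty product 1, which need
      not lie in \<open>I\<close>.\<close>
    proof (cases "P = {p}")
      case True
      then show ?thesis using psubset.prems(1) by blast
    next
      case False
      then obtain q where q: "q \<in> P" "q \<noteq> p" using p by blast
      have "b \<in> I"
        unfolding b_def using q a by (intro ideal_prod_mem[OF assms(2) fin, of q]) auto
      then have "a p + b \<in> I" using a[OF p] is_ideal_add[OF assms(2)] by blast
      then obtain r where r: "r \<in> P" "a p + b \<in> r" using psubset.prems(1) by blast
      have b_notin: "b \<notin> p"
        using prime_ideal_prod[OF psubset.prems(2)[OF p] fin] a p unfolding b_def by blast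
      \<comment> \<open>If \<open>r\<close> is \<open>p\<close>, then \<open>a p\<close> cancels and
        \<open>b\<close> lands in \<open>p\<close>. Otherwise \<open>a r\<close> is a factor of
        \<open>b\<close>, so \<open>b\<close> cancels and \<open>a p\<close> lands in a foreign
        prime.\<close>
      show ?thesis
      proof (cases "r = p")
        case True
        then show ?thesis using r psubset.prems(3) a_self[OF p] b_notin by blast
      next
        case False
        have "b \<in> r"
          unfolding b_def using r False a_self psubset.prems(2)
          by (intro ideal_prod_mem[OF _ fin, of r]) (auto simp: prime_ideal_is_ideal)
        then have "a p \<in> r" using r psubset.prems(3)[of r b "a p"] by (simp add: add.commute)
        then show ?thesis using a[OF p] r False by blast
      qed
    qed
  qed
qed

lemma annihilator_subtractive: "a + b \<in> annihilator t \<Longrightarrow> a \<in> annihilator t \<Longrightarrow> b \<in> annihilator t"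
  by (simp add: annihilator_def distrib_right)

lemma prime_annihilator_nonzero: "prime_ideal (annihilator t) \<Longrightarrow> t \<noteq> 0"
  by (auto simp: prime_ideal_def annihilator_def)

section \<open>Contents in Ohm-Rush semialgebras\<close>

lemma is_ideal_extend_ideal: "is_ideal (extend_ideal h I)"
  unfolding extend_ideal_def by (rule is_ideal_ideal_generated)

lemma is_ideal_content: "is_ideal (ohm_rush_content h f)"
  unfolding ohm_rush_content_def by (rule is_ideal_Inter) blast

lemma content_subset: "is_ideal I \<Longrightarrow> f \<in> extend_ideal h I \<Longrightarrow> ohm_rush_content h f \<subseteq> I"
  unfolding ohm_rush_content_def by blast

lemma content_zero: "ohm_rush_content h 0 = {0}"
  using content_subset[OF is_ideal_singleton_zero is_ideal_zero[OF is_ideal_extend_ideal]]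
    is_ideal_zero[OF is_ideal_content] by blast

lemma extend_ideal_subset_annihilator:
  assumes "\<And>s. s \<in> I \<Longrightarrow> h s * g = 0"
  shows "extend_ideal h I \<subseteq> annihilator g"
  unfolding extend_ideal_def using assms
  by (intro ideal_generated_minimal is_ideal_annihilator) (auto simp: annihilator_def)

text \<open>Forwards, homogeneity turns \<open>h s * f = 0\<close> into s c(f) = c(0) = 0.
  Backwards, f lies in c(f)B by the Ohm-Rush property, and \<open>h s\<close> kills the generators
  of that ideal.\<close>

lemma mult_eq_0_iff_content:
  assumes "ohm_rush_semialgebra h" "homogeneous_content h"
  shows "h s * f = 0 \<longleftrightarrow> ohm_rush_content h f \<subseteq> annihilator s"
proof
  assume "h s * f = 0"
  then have "(*) s ` ohm_rush_content h f = {0}"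
    using assms(2) content_zero unfolding homogeneous_content_def by metis
  then show "ohm_rush_content h f \<subseteq> annihilator s"
    by (auto simp: annihilator_def mult.commute)
next
  assume *: "ohm_rush_content h f \<subseteq> annihilator s"
  have h: "h 0 = 0" "\<And>s t. h (s * t) = h s * h t"
    using assms(1) by (auto simp: ohm_rush_semialgebra_def semialgebra_def)
  have "extend_ideal h (ohm_rush_content h f) \<subseteq> annihilator (h s)"
    using * h by (intro extend_ideal_subset_annihilator) (auto simp: annihilator_def simp flip: h(2))
  then show "h s * f = 0"
    using assms(1) by (auto simp: ohm_rush_semialgebra_def annihilator_def mult.commute)
qed

text \<open>A prime containing c(fg) contains its radical, hence all products of elements of c(f)
  and c(g). If some element of c(f) is outside \<open>p\<close>, all of c(g) is forced into
  \<open>p\<close>.\<close>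

lemma content_mult_subset_prime:
  assumes "weak_content_semialgebra h" "prime_ideal p" "ohm_rush_content h (f * g) \<subseteq> p"
  shows "ohm_rush_content h f \<subseteq> p \<or> ohm_rush_content h g \<subseteq> p"
proof -
  have "a * b \<in> p" if "a \<in> ohm_rush_content h f" "b \<in> ohm_rush_content h g" for a b
  proof -
    have "a * b \<in> ideal_mult (ohm_rush_content h f) (ohm_rush_content h g)"
      unfolding ideal_mult_def using that by (intro subsetD[OF ideal_generated_superset]) blast
    also have "\<dots> \<subseteq> ideal_radical (ohm_rush_content h (f * g))"
      using assms(1) by (simp add: weak_content_semialgebra_def)
    also have "\<dots> \<subseteq> p"
      by (rule ideal_radical_subset_prime[OF assms(2,3)])
    finally show ?thesis .
  qed
  then show ?thesis
    using prime_ideal_mult[OF assms(2)] by blast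
qed

lemma prime_annihilator_extend:
  assumes "weak_content_semialgebra h" "homogeneous_content h" "inj h"
    and prime: "prime_ideal (annihilator t)"
  shows "prime_ideal (annihilator (h t))"
proof -
  have oh: "ohm_rush_semialgebra h"
    using assms(1) by (simp add: weak_content_semialgebra_def)
  then have "h 0 = 0"
    by (simp add: ohm_rush_semialgebra_def semialgebra_def)
  \<comment> \<open>Injectivity enters here: it makes \<open>annihilator (h t)\<close> a proper
    ideal.\<close>
  then have "h t \<noteq> 0"
    using prime_annihilator_nonzero[OF prime] assms(3) by (metis injD)
  then have "1 \<notin> annihilator (h t)"
    by (simp add: annihilator_def)
  then have "annihilator (h t) \<noteq> UNIV" by blast
  moreover have mem: "f \<in> annihilator (h t) \<longleftrightarrow> ohm_rush_content h f \<subseteq> annihilator t" for f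
    using mult_eq_0_iff_content[OF oh assms(2), of t f] by (simp add: annihilator_def mult.commute)
  ultimately show ?thesis
    using content_mult_subset_prime[OF assms(1) prime]
    unfolding prime_ideal_def by (auto simp: mem is_ideal_annihilator)
qed

text \<open>Injectivity carries a nonzero cofactor from the base to B. In the other direction a
  nonzero g killed by \<open>h s\<close> has nonzero content, and \<open>s\<close> kills every
  element of that content.\<close>

lemma zero_divisor_iff_semialgebra:
  assumes "ohm_rush_semialgebra h" "homogeneous_content h" "inj h"
  shows "h s \<in> zero_divisors \<longleftrightarrow> s \<in> zero_divisors"
proof
  have h: "h 0 = 0" "\<And>s t. h (s * t) = h s * h t"
    using assms(1) by (auto simp: ohm_rush_semialgebra_def semialgebra_def)
  {
    assume "s \<in> zero_divisors"
    then obtain t where "t \<noteq> 0" "s * t = 0" by (auto simp: zero_divisors_def)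
    then have "h t \<noteq> 0" "h s * h t = 0"
      using h assms(3) by (metis injD, metis)
    then show "h s \<in> zero_divisors" by (auto simp: zero_divisors_def)
  next
    assume "h s \<in> zero_divisors"
    then obtain g where g: "g \<noteq> 0" "h s * g = 0" by (auto simp: zero_divisors_def)
    have "\<not> ohm_rush_content h g \<subseteq> {0}"
    proof
      assume "ohm_rush_content h g \<subseteq> {0}"
      \<comment> \<open>Since the annihilator of 1 is zero, the content criterion at s = 1 gives g =
        0.\<close>
      then have "ohm_rush_content h g \<subseteq> annihilator 1"
        by (auto simp: annihilator_def)
      then have "h 1 * g = 0"
        using mult_eq_0_iff_content[OF assms(1,2)] by blast
      then show False
        using g(1) assms(1) by (simp add: ohm_rush_semialgebra_def semialgebra_def)
    qed
    then obtain t where "t \<in> ohm_rush_content h g" "t \<noteq> 0" by blast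
    moreover have "ohm_rush_content h g \<subseteq> annihilator s"
      using g(2) mult_eq_0_iff_content[OF assms(1,2)] by blast
    ultimately show "s \<in> zero_divisors"
      by (auto simp: zero_divisors_def annihilator_def mult.commute)
  }
qed

lemma prime_annihilator_contract:
  assumes oh: "ohm_rush_semialgebra h" and "homogeneous_content h"
    and prime: "prime_ideal (annihilator g)"
  shows "h -` annihilator g \<in> associated_primes"
proof -
  let ?p = "h -` annihilator g"
  have h: "h 0 = 0" "h 1 = 1" "\<And>s t. h (s + t) = h s + h t" "\<And>s t. h (s * t) = h s * h t"
    using oh by (auto simp: ohm_rush_semialgebra_def semialgebra_def)
  have "0 \<in> ?p" "1 \<notin> ?p"
    using h prime_ideal_one_notin[OF prime] by (auto simp: annihilator_def)
  then have "?p \<noteq> {}" "?p \<noteq> UNIV" by blast+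
  then have prime_p: "prime_ideal ?p"
    using prime unfolding prime_ideal_def is_ideal_def by (auto simp: h)
  have mem: "s \<in> ?p \<longleftrightarrow> ohm_rush_content h g \<subseteq> annihilator s" for s
    using mult_eq_0_iff_content[OF assms(1,2), of s g] by (simp add: annihilator_def)
  have "g \<in> ideal_generated (h ` ohm_rush_content h g)"
    using oh by (simp add: ohm_rush_semialgebra_def extend_ideal_def)
  then obtain F where F: "finite F" "F \<subseteq> ohm_rush_content h g" "g \<in> extend_ideal h F"
    unfolding extend_ideal_def by (metis ideal_generated_finite_subset finite_subset_image)
  have "\<exists>t\<in>F. annihilator t \<subseteq> ?p"
  proof (rule ccontr)
    assume "\<not> ?thesis"
    then have "\<forall>t\<in>F. \<exists>s. s * t = 0 \<and> s \<notin> ?p" by (auto simp: annihilator_def)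
    then obtain s where s: "\<And>t. t \<in> F \<Longrightarrow> s t * t = 0 \<and> s t \<notin> ?p" by metis
    have "h t * h (\<Prod>u\<in>F. s u) = 0" if "t \<in> F" for t
    proof -
      have "(\<Prod>u\<in>F. s u) \<in> annihilator t"
        using s that by (intro ideal_prod_mem[OF is_ideal_annihilator F(1)]) (auto simp: annihilator_def)
      then show ?thesis
        using h(1) by (simp add: annihilator_def mult.commute flip: h(4))
    qed
    then have "g \<in> annihilator (h (\<Prod>u\<in>F. s u))"
      using extend_ideal_subset_annihilator F(3) by blast
    then have "(\<Prod>u\<in>F. s u) \<in> ?p"
      by (simp add: annihilator_def mult.commute)
    then show False
      using prime_ideal_prod[OF prime_p F(1)] s by blast
  qed
  then obtain t where "t \<in> F" "annihilator t \<subseteq> ?p" by blast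
  \<comment> \<open>An element of \<open>?p\<close> kills the whole content of g, in particular
    \<open>t\<close>.\<close>
  moreover have "?p \<subseteq> annihilator t"
    using mem \<open>t \<in> F\<close> F(2) by (auto simp: annihilator_def mult.commute subset_iff)
  ultimately have "?p = annihilator t" by blast
  then show ?thesis
    unfolding associated_primes_def using prime_p by blast
qed

theorem theorem4p5:
  fixes h :: "'a::comm_semiring_1 \<Rightarrow> 'b::comm_semiring_1"
  assumes "weak_gaussian TYPE('a)"
    and "mccoy_semialgebra h"
    and "weak_content_semialgebra h"
    and "homogeneous_content h"
    and "inj h"
  shows "very_few_zero_divisors TYPE('a) \<longleftrightarrow> very_few_zero_divisors TYPE('b)"
proof
  have oh: "ohm_rush_semialgebra h"
    using assms(2) by (simp add: mccoy_semialgebra_def)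
  {
    assume "very_few_zero_divisors TYPE('a)"
    then obtain P :: "'a set set" where P: "finite P" "P \<subseteq> associated_primes" "zero_divisors = \<Union>P"
      unfolding very_few_zero_divisors_def by blast
    then have "\<forall>p\<in>P. \<exists>t. prime_ideal p \<and> p = annihilator t"
      by (auto simp: associated_primes_def)
    then obtain t where t: "\<And>p. p \<in> P \<Longrightarrow> prime_ideal p \<and> p = annihilator (t p)" by metis
    let ?Q = "(\<lambda>p. annihilator (h (t p))) ` P"
    have prime: "prime_ideal (annihilator (h (t p)))" if "p \<in> P" for p
      using t[OF that] prime_annihilator_extend[OF assms(3-5)] by metis
    have "f \<in> \<Union>?Q" if zd: "f \<in> zero_divisors" for f
    proof -
      obtain g where "g \<noteq> 0" "g * f = 0"
        using zd by (auto simp: zero_divisors_def mult.commute)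
      then obtain s where s: "s \<noteq> 0" "(*) s ` ohm_rush_content h f = {0}"
        using assms(2) unfolding mccoy_semialgebra_def by blast
      \<comment> \<open>One nonzero \<open>s\<close> kills the whole content, so all its elements
        are zero-divisors of the base.\<close>
      then have "ohm_rush_content h f \<subseteq> \<Union>P"
        unfolding P(3)[symmetric] by (auto simp: zero_divisors_def mult.commute)
      then have "\<exists>p\<in>P. ohm_rush_content h f \<subseteq> p"
      proof (rule prime_avoidance[OF P(1) is_ideal_content])
        show "prime_ideal p" if "p \<in> P" for p
          using t[OF that] by blast
        show "b \<in> p" if "p \<in> P" "a + b \<in> p" "a \<in> p" for p a b
          using t[OF that(1)] annihilator_subtractive[of a b "t p"] that(2,3) by metis
      qed
      then obtain p where "p \<in> P" "ohm_rush_content h f \<subseteq> annihilator (t p)"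
        using t by metis
      then have "f \<in> annihilator (h (t p))"
        using mult_eq_0_iff_content[OF oh assms(4), of "t p" f]
        by (simp add: annihilator_def mult.commute)
      then show ?thesis using \<open>p \<in> P\<close> by blast
    qed
    \<comment> \<open>Each \<open>h (t p)\<close> is nonzero because its annihilator is prime, hence
      proper.\<close>
    moreover have "\<Union>?Q \<subseteq> zero_divisors"
      using prime prime_annihilator_nonzero by (fastforce simp: zero_divisors_def annihilator_def)
    ultimately have "zero_divisors = \<Union>?Q" by blast
    moreover have "?Q \<subseteq> associated_primes"
      using prime by (auto simp: associated_primes_def)
    ultimately show "very_few_zero_divisors TYPE('b)"
      unfolding very_few_zero_divisors_def using P(1) by blast
  next
    assume "very_few_zero_divisors TYPE('b)"
    then obtain Q :: "'b set set" where Q: "finite Q" "Q \<subseteq> associated_primes" "zero_divisors = \<Union>Q"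
      unfolding very_few_zero_divisors_def by blast
    \<comment> \<open>The zero-divisors of the base are the contraction of those of B, and preimages
      commute with unions, so the contracted primes form the required finite family.\<close>
    have "zero_divisors = h -` (zero_divisors :: 'b set)"
      using zero_divisor_iff_semialgebra[OF oh assms(4,5)] by blast
    also have "\<dots> = \<Union>((-`) h ` Q)"
      unfolding Q(3) by auto
    finally have "zero_divisors = \<Union>((-`) h ` Q)" .
    moreover have "(-`) h ` Q \<subseteq> associated_primes"
      using Q(2) prime_annihilator_contract[OF oh assms(4)]
      by (fastforce simp: associated_primes_def[where 'a = 'b])
    ultimately show "very_few_zero_divisors TYPE('a)"
      unfolding very_few_zero_divisors_def using Q(1) by blast
  }
qed

end
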